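(* Let $T>0$ and let $\mathsf H:[0,T]\to\mathbb C^{N\times N}$ be continuously differentiable with $\mathsf H(t)$ Hermitian for every $t$. Put $\mathsf K(t)=i\dot{\mathsf H}(t)+\mathsf H(t)^2$. Then: (i) every solution $\psi:[0,T]\to\mathbb C^N$ of the Schrödinger equation $\dot\psi(t)=-i\mathsf H(t)\psi(t)$ satisfies $\ddot\psi(t)=-\mathsf K(t)\psi(t)$ on $[0,T]$; (ii) conversely, if $\psi:[0,T]\to\mathbb C^N$ is a twice differentiable solution of $\ddot\psi(t)=-\mathsf K(t)\psi(t)$ on $[0,T]$ whose initial values satisfy $\dot\psi(0)=-i\mathsf H(0)\psi(0)$, then $\dot\psi(t)=-i\mathsf H(t)\psi(t)$ for all $t\in[0,T]$.
   Context: Overdots denote derivatives with respect to $t$ (one-sided at the endpoints of $[0,T]$). $N=2^n$ is the dimension of the state space of $n$ qubits; $\mathsf H(t)$ is a time-dependent Hamiltonian, with $\hbar=1$. *)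

theory Defs
  imports "HOL-Analysis.Analysis"
begin

text \<open>
  Functions of time are total functions on \<^typ>\<open>real\<close>; only their values on \<open>{0..T}\<close> matter.
  The derivative is taken within \<open>{0..T}\<close>, so it is one-sided at the endpoints.
  It is the actual derivative only where the function is differentiable within \<open>{0..T}\<close>;
  the definitions below state differentiability separately.
\<close>

definition tderiv :: "real \<Rightarrow> (real \<Rightarrow> 'a::real_normed_vector) \<Rightarrow> real \<Rightarrow> 'a" where
  "tderiv T f t = vector_derivative f (at t within {0..T})"

definition continuously_differentiable :: "real \<Rightarrow> (real \<Rightarrow> 'a::real_normed_vector) \<Rightarrow> bool" where
  "continuously_differentiable T f \<longleftrightarrow>
     f differentiable_on {0..T} \<and> continuous_on {0..T} (tderiv T f)"

definition twice_differentiable :: "real \<Rightarrow> (real \<Rightarrow> 'a::real_normed_vector) \<Rightarrow> bool" where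
  "twice_differentiable T f \<longleftrightarrow>
     f differentiable_on {0..T} \<and> tderiv T f differentiable_on {0..T}"

definition hermitian :: "complex ^ 'd ^ 'd \<Rightarrow> bool" where
  "hermitian A \<longleftrightarrow> transpose (map_matrix cnj A) = A"

text \<open>
  The matrix square is written with \<open>**\<close>; the scalar multiple of a complex matrix is
  \<open>map_matrix ((*) c)\<close>, since \<open>*s\<close> applies to vectors only.
\<close>

definition Kmat :: "real \<Rightarrow> (real \<Rightarrow> complex ^ 'd ^ 'd) \<Rightarrow> real \<Rightarrow> complex ^ 'd ^ 'd" where
  "Kmat T H t = map_matrix ((*) \<i>) (tderiv T H t) + H t ** H t"

definition solves_schroedinger ::
  "real \<Rightarrow> (real \<Rightarrow> complex ^ 'd ^ 'd) \<Rightarrow> (real \<Rightarrow> complex ^ 'd) \<Rightarrow> bool" where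
  "solves_schroedinger T H \<psi> \<longleftrightarrow>
     \<psi> differentiable_on {0..T} \<and>
     (\<forall>t\<in>{0..T}. tderiv T \<psi> t = (- \<i>) *s (H t *v \<psi> t))"

definition solves_second_order ::
  "real \<Rightarrow> (real \<Rightarrow> complex ^ 'd ^ 'd) \<Rightarrow> (real \<Rightarrow> complex ^ 'd) \<Rightarrow> bool" where
  "solves_second_order T K \<psi> \<longleftrightarrow>
     twice_differentiable T \<psi> \<and>
     (\<forall>t\<in>{0..T}. tderiv T (tderiv T \<psi>) t = - (K t *v \<psi> t))"

end

theory Submission
  imports Defs
begin

text \<open>
  The defect \<open>\<phi> = \<psi>' + \<i> H \<psi>\<close> of the Schroedinger equation satisfies
  \<open>\<phi>' = \<i> H \<phi>\<close> along every solution of the second-order equation. Since \<open>H\<close> is Hermitian, this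
  flow preserves the norm, so \<open>\<phi>\<close> vanishes identically as soon as \<open>\<phi> 0 = 0\<close>.
\<close>

lemma tderiv_has_vector_derivative:
  assumes "f differentiable_on {0..T}" "t \<in> {0..T}"
  shows "(f has_vector_derivative tderiv T f t) (at t within {0..T})"
  using assms by (simp add: differentiable_on_def tderiv_def flip: vector_derivative_works)

text \<open>Since \<open>T > 0\<close>, every point of the interval, endpoints included, is a limit
  point of it, so the derivative within the interval is unique.\<close>

lemma tderiv_eqI:
  assumes "T > 0" "t \<in> {0..T}" "(f has_vector_derivative D) (at t within {0..T})"
  shows "tderiv T f t = D"
  unfolding tderiv_def using assms vector_derivative_within_cbox[of 0 T t f D] by simp

lemma scaleR_vec_complex: "r *\<^sub>R (x :: complex ^ 'd) = complex_of_real r *s x"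
  by (simp add: vec_eq_iff scaleR_conv_of_real[where 'a = complex])

lemma matrix_vector_mult_minus_right: "A *v (- x) = - (A *v x)"
  for A :: "'a::ring_1 ^ 'n ^ 'm"
  by (simp add: vec_eq_iff matrix_vector_mult_def sum_negf)

lemma map_matrix_mult_vector: "map_matrix ((*) c) A *v x = c *s (A *v x)"
  for A :: "'a::comm_semiring_1 ^ 'n ^ 'm"
  by (simp add: vec_eq_iff matrix_vector_mult_def map_matrix_def sum_distrib_left mult.assoc)

text \<open>Time is real, so the product rule asks only for bilinearity over the reals; boundedness
  is automatic in finite dimension. With \<open>c\<close> built in, one rule serves both factors
  \<open>- \<i>\<close> and \<open>\<i>\<close>.\<close>

lemma bounded_bilinear_smult_matrix_vector_mult:
  "bounded_bilinear (\<lambda>(A :: complex ^ 'n ^ 'm) x. c *s (A *v x))"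
proof -
  have "linear (\<lambda>x. c *s (A *v x))" for A :: "complex ^ 'n ^ 'm"
    by (rule linearI) (simp_all add: algebra_simps scaleR_vec_complex vector_smult_assoc
        matrix_vector_mult_add_rdistrib vector_scalar_commute vector_add_ldistrib)
  moreover have "linear (\<lambda>A :: complex ^ 'n ^ 'm. c *s (A *v x))" for x
    by (rule linearI) (simp_all add: vec_eq_iff matrix_vector_mult_def algebra_simps
        sum.distrib sum_distrib_left scaleR_conv_of_real[where 'a = complex])
  ultimately show ?thesis
    by (simp add: bilinear_def flip: bilinear_conv_bounded_bilinear)
qed

lemma smult_matrix_vector_mult_has_vector_derivative:
  fixes A :: "real \<Rightarrow> complex ^ 'n ^ 'm"
  assumes "(A has_vector_derivative A') (at t within S)"
    and "(x has_vector_derivative x') (at t within S)"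
  shows "((\<lambda>t. c *s (A t *v x t)) has_vector_derivative c *s (A t *v x') + c *s (A' *v x t))
    (at t within S)"
  by (rule bounded_bilinear.has_vector_derivative
      [OF bounded_bilinear_smult_matrix_vector_mult assms])

lemma hermitian_component:
  assumes "hermitian A"
  shows "cnj (A $ i $ j) = A $ j $ i"
proof -
  have "A $ j $ i = transpose (map_matrix cnj A) $ j $ i"
    using assms by (simp add: hermitian_def)
  then show ?thesis
    by (simp add: transpose_def map_matrix_def)
qed

lemma inner_vec_complex: "(x :: complex ^ 'd) \<bullet> y = Re (\<Sum>i\<in>UNIV. cnj (x $ i) * y $ i)"
  by (simp add: inner_vec_def inner_complex_def)

text \<open>The real inner product is the real part of the sesquilinear one. The quadratic form of a
  Hermitian matrix is real, so multiplying it by \<open>\<i>\<close> leaves no real part.\<close>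

lemma hermitian_inner_imaginary_zero:
  assumes "hermitian A"
  shows "x \<bullet> (\<i> *s (A *v x)) = 0"
proof -
  define s where "s = (\<Sum>i\<in>UNIV. \<Sum>j\<in>UNIV. cnj (x $ i) * A $ i $ j * x $ j)"
  \<comment> \<open>Conjugation turns \<open>A $ i $ j\<close> into \<open>A $ j $ i\<close>, which
    amounts to exchanging the two summation indices.\<close>
  have "cnj s = (\<Sum>i\<in>UNIV. \<Sum>j\<in>UNIV. cnj (x $ j) * A $ j $ i * x $ i)"
    unfolding s_def by (simp add: hermitian_component[OF assms] mult_ac)
  also have "\<dots> = s"
    unfolding s_def by (rule sum.swap)
  finally have "Im s = 0"
    by (metis Reals_cnj_iff complex_is_Real_iff)
  moreover have "x \<bullet> (\<i> *s (A *v x)) = Re (\<i> * s)"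
    unfolding inner_vec_complex s_def
    by (simp only: vector_smult_component matrix_vector_mult_def vec_lambda_beta
        sum_distrib_left mult_ac)
  ultimately show ?thesis
    by simp
qed

text \<open>Conservation of norm: the derivative of \<open>\<phi> t \<bullet> \<phi> t\<close> is
  twice the inner product of \<open>\<phi> t\<close> with \<open>\<i> *s (H t *v \<phi> t)\<close>,
  which is zero. The squared norm thus keeps its initial value 0.\<close>

lemma hermitian_flow_zero:
  fixes H :: "real \<Rightarrow> complex ^ 'd ^ 'd"
  assumes deriv: "\<And>t. t \<in> {0..T} \<Longrightarrow>
      (\<phi> has_vector_derivative \<i> *s (H t *v \<phi> t)) (at t within {0..T})"
    and herm: "\<And>t. t \<in> {0..T} \<Longrightarrow> hermitian (H t)"
    and init: "\<phi> 0 = 0"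
    and t: "t \<in> {0..T}"
  shows "\<phi> t = 0"
proof -
  have "((\<lambda>t. \<phi> t \<bullet> \<phi> t) has_vector_derivative 0) (at s within {0..T})" if s: "s \<in> {0..T}" for s
    using bounded_bilinear.has_vector_derivative[OF bounded_bilinear_inner deriv[OF s] deriv[OF s]]
      hermitian_inner_imaginary_zero[OF herm[OF s]]
    by (simp add: inner_commute)
  then obtain c where "\<And>s. s \<in> {0..T} \<Longrightarrow> \<phi> s \<bullet> \<phi> s = c"
    using has_vector_derivative_zero_constant[of "{0..T}" "\<lambda>t. \<phi> t \<bullet> \<phi> t"] by auto
  from this[of t] this[of 0] show ?thesis
    using t init by auto
qed

lemma Kmat_mult_vector:
  "Kmat T H t *v x = \<i> *s (tderiv T H t *v x) + H t *v (H t *v x)"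
  by (simp add: Kmat_def matrix_vector_mult_add_rdistrib map_matrix_mult_vector
      matrix_vector_mul_assoc)

text \<open>The right-hand side of the first-order equation is itself differentiable, which yields
  the second derivative of \<open>\<psi>\<close>. In the product rule, inserting the equation once
  more turns \<open>- \<i> H \<psi>'\<close> into \<open>- H^2 \<psi>\<close>.\<close>

lemma schroedinger_imp_second_order:
  assumes "T > 0" "H differentiable_on {0..T}" "solves_schroedinger T H \<psi>"
  shows "solves_second_order T (Kmat T H) \<psi>"
proof -
  have \<psi>: "\<psi> differentiable_on {0..T}"
    and eq: "\<And>t. t \<in> {0..T} \<Longrightarrow> tderiv T \<psi> t = (- \<i>) *s (H t *v \<psi> t)"
    using assms(3) by (auto simp: solves_schroedinger_def)
  have D: "(tderiv T \<psi> has_vector_derivative - (Kmat T H t *v \<psi> t)) (at t within {0..T})"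
    if t: "t \<in> {0..T}" for t
  proof -
    have "((\<lambda>t. (- \<i>) *s (H t *v \<psi> t)) has_vector_derivative
        (- \<i>) *s (H t *v tderiv T \<psi> t) + (- \<i>) *s (tderiv T H t *v \<psi> t)) (at t within {0..T})"
      using assms(2) \<psi> t
      by (intro smult_matrix_vector_mult_has_vector_derivative tderiv_has_vector_derivative)
    moreover have "(- \<i>) *s (H t *v tderiv T \<psi> t) + (- \<i>) *s (tderiv T H t *v \<psi> t)
        = - (Kmat T H t *v \<psi> t)"
      by (simp add: eq[OF t] Kmat_mult_vector vector_scalar_commute vec_eq_iff
          matrix_vector_mult_minus_right)
    \<comment> \<open>The two functions agree only on \<open>{0..T}\<close>, which suffices for a
      derivative taken within that set.\<close>
    ultimately show ?thesis
      using t by (auto intro: has_vector_derivative_transform[OF t eq])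
  qed
  then have "tderiv T \<psi> differentiable_on {0..T}"
    by (meson differentiable_on_def differentiableI_vector)
  with \<psi> show ?thesis
    using tderiv_eqI[OF assms(1) _ D] by (simp add: solves_second_order_def twice_differentiable_def)
qed

lemma second_order_imp_schroedinger:
  assumes "H differentiable_on {0..T}"
    and herm: "\<And>t. t \<in> {0..T} \<Longrightarrow> hermitian (H t)"
    and sol: "solves_second_order T (Kmat T H) \<psi>"
    and init: "tderiv T \<psi> 0 = (- \<i>) *s (H 0 *v \<psi> 0)"
    and t: "t \<in> {0..T}"
  shows "tderiv T \<psi> t = (- \<i>) *s (H t *v \<psi> t)"
proof -
  define \<phi> where "\<phi> = (\<lambda>t. tderiv T \<psi> t + \<i> *s (H t *v \<psi> t))"
  have \<psi>: "\<psi> differentiable_on {0..T}" "tderiv T \<psi> differentiable_on {0..T}"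
    and eq: "\<And>t. t \<in> {0..T} \<Longrightarrow> tderiv T (tderiv T \<psi>) t = - (Kmat T H t *v \<psi> t)"
    using sol by (auto simp: solves_second_order_def twice_differentiable_def)
  have D: "(\<phi> has_vector_derivative \<i> *s (H s *v \<phi> s)) (at s within {0..T})"
    if s: "s \<in> {0..T}" for s
  proof -
    have "(\<phi> has_vector_derivative tderiv T (tderiv T \<psi>) s +
        (\<i> *s (H s *v tderiv T \<psi> s) + \<i> *s (tderiv T H s *v \<psi> s))) (at s within {0..T})"
      unfolding \<phi>_def using assms(1) \<psi> s
      by (intro has_vector_derivative_add smult_matrix_vector_mult_has_vector_derivative
          tderiv_has_vector_derivative)
    \<comment> \<open>The terms with \<open>H'\<close> cancel, and what remains factors: \<open>\<i>
      H \<psi>' - H^2 \<psi> = \<i> H (\<psi>' + \<i> H \<psi>)\<close>.\<close>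
    moreover have "tderiv T (tderiv T \<psi>) s +
        (\<i> *s (H s *v tderiv T \<psi> s) + \<i> *s (tderiv T H s *v \<psi> s)) = \<i> *s (H s *v \<phi> s)"
      by (simp add: eq[OF s] \<phi>_def Kmat_mult_vector vector_scalar_commute vec_eq_iff
          matrix_vector_right_distrib algebra_simps)
    ultimately show ?thesis
      by simp
  qed
  \<comment> \<open>The condition on the initial values says exactly that the defect vanishes at
    time 0.\<close>
  have "\<phi> 0 = 0"
    by (simp add: \<phi>_def init vec_eq_iff)
  then have "\<phi> t = 0"
    using hermitian_flow_zero[OF D herm] t by blast
  then show ?thesis
    by (simp add: \<phi>_def vec_eq_iff eq_neg_iff_add_eq_0)
qed

theorem mainTheorem3:
  fixes n :: nat
    and T :: real
    and H :: "real \<Rightarrow> complex ^ 'd::finite ^ 'd"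
  assumes "CARD('d) = 2 ^ n"
    and "T > 0"
    and "continuously_differentiable T H"
    and "\<forall>t\<in>{0..T}. hermitian (H t)"
  shows "(\<forall>\<psi> :: real \<Rightarrow> complex ^ 'd.
            solves_schroedinger T H \<psi> \<longrightarrow> solves_second_order T (Kmat T H) \<psi>) \<and>
         (\<forall>\<psi> :: real \<Rightarrow> complex ^ 'd.
            solves_second_order T (Kmat T H) \<psi> \<and>
            tderiv T \<psi> 0 = (- \<i>) *s (H 0 *v \<psi> 0) \<longrightarrow>
            (\<forall>t\<in>{0..T}. tderiv T \<psi> t = (- \<i>) *s (H t *v \<psi> t)))"
proof (intro conjI allI impI ballI)
  have H: "H differentiable_on {0..T}"
    using assms(3) by (simp add: continuously_differentiable_def)
  show "solves_second_order T (Kmat T H) \<psi>" if "solves_schroedinger T H \<psi>"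
    for \<psi> :: "real \<Rightarrow> complex ^ 'd"
    using schroedinger_imp_second_order[OF assms(2) H that] .
  show "tderiv T \<psi> t = (- \<i>) *s (H t *v \<psi> t)"
    if "solves_second_order T (Kmat T H) \<psi> \<and> tderiv T \<psi> 0 = (- \<i>) *s (H 0 *v \<psi> 0)"
      and "t \<in> {0..T}" for \<psi> :: "real \<Rightarrow> complex ^ 'd" and t
    using second_order_imp_schroedinger[OF H] assms(4) that by blast
qed

end
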